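(* Let $X$ be the space of propositional sentences with size measure $f$, number-of-variables function $\alpha$, and classes $X^\alpha_n=\{x\in X:\alpha(x)=n\}$, and let $T(x)=f(x)\cdot(\min_{\alpha(x)}(\mathcal K(x))+1)$ be the running time of the exhaustive satisfiability-testing program (all as defined in the context). Let $\mu:X\to[0,1]$ be a probability distribution on $X$ such that for every $n\in\omega$ and all $\mathcal K,\mathcal L\subseteq\{0,\dots,2^n-1\}$, $\mu(X^\alpha_n\cap Th(\mathcal K))=\mu(X^\alpha_n\cap Th(\mathcal L))$. Then $T^{f,\mu}_{avg,\alpha}\in O(2\times\bullet)$, i.e. for every $n\in\omega$ with $\mu(X^\alpha_n)\neq 0$, $$\sum_{x\in X^\alpha_n}\frac{T(x)}{2 f(x)}\,\mu(x)\le \mu(X^\alpha_n).$$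
   Context: $\omega=\{0,1,2,\dots\}$. Fix a countably infinite, enumerated set of propositional variables and a functionally complete set of logical connectives. $X$ is the (countable) set of all propositional sentences, in reverse Polish form and represented by binary strings (distinct sentences having distinct codes); $f(x)\in\omega$ is the length in bits of the code of $x$ (so $f(x)\ge 1$), and $\alpha(x)$ is the number of distinct propositional variables occurring in $x$; one has $\alpha(x)\le f(x)$. For $x$ with $\alpha(x)=n$, list the $n$ variables occurring in $x$ in the order of the fixed enumeration; a truth assignment to them is a binary sequence of length $n$, identified with the number in $\{0,\dots,2^n-1\}$ having that binary representation. The model $\mathcal K(x)\subseteq\{0,\dots,2^n-1\}$ is the set of all assignments making $x$ true. For $\mathcal K\subseteq\{0,\dots,2^n-1\}$, $X^\alpha_n\cap Th(\mathcal K)$ is the set of $x\in X^\alpha_n$ with $\mathcal K(x)=\mathcal K$. Put $\min_n(\mathcal K)=2^n$ if $\mathcal K=\emptyset$ and $\min_n(\mathcal K)=$ least element of $\mathcal K$ otherwise. The program tests the assignments $0,1,\dots,2^n-1$ in order until one satisfies $x$ or all are exhausted; its running time (in abstract units) is taken to be $T(x)=f(x)\cdot(\min_{\alpha(x)}(\mathcal K(x))+1)$. For $Y\subseteq X$, $\mu(Y)=\sum_{x\in Y}\mu(x)$, with $\mu(X)=1$. For $F$ positive at all values of $f$, $T^{f,\mu}_{avg,\alpha}\in O(F)$ means: for every $n$ with $\mu(X^\alpha_n)\ne0$, $\sum_{x\in X^\alpha_n}\frac{T(x)}{F(f(x))}\mu(x)\le\mu(X^\alpha_n)$. The symbol $2\times\bullet$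 denotes the function $k\mapsto 2k$. *)

theory Defs
  imports "HOL-Analysis.Analysis"
begin

(* Variables are enumerated by nat. The connectives are the elements of 'c: connective c takes
   ar c arguments and has the truth function I c. Only trees respecting ar are sentences. *)

datatype 'c tree = Var nat | App 'c "'c tree list"

fun well_formed :: "('c \<Rightarrow> nat) \<Rightarrow> 'c tree \<Rightarrow> bool" where
  "well_formed ar (Var v) \<longleftrightarrow> True"
| "well_formed ar (App c ts) \<longleftrightarrow> length ts = ar c \<and> (\<forall>t\<in>set ts. well_formed ar t)"

definition sentences :: "('c \<Rightarrow> nat) \<Rightarrow> 'c tree set" where
  "sentences ar = {x. well_formed ar x}"

fun vars :: "'c tree \<Rightarrow> nat set" where
  "vars (Var v) = {v}"
| "vars (App c ts) = (\<Union>t\<in>set ts. vars t)"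

fun eval :: "('c \<Rightarrow> bool list \<Rightarrow> bool) \<Rightarrow> (nat \<Rightarrow> bool) \<Rightarrow> 'c tree \<Rightarrow> bool" where
  "eval I \<sigma> (Var v) = \<sigma> v"
| "eval I \<sigma> (App c ts) = I c (map (eval I \<sigma>) ts)"

(* Arity 0 is excluded, as usual: {NAND} is complete although it has no closed sentences. *)
definition functionally_complete :: "('c \<Rightarrow> nat) \<Rightarrow> ('c \<Rightarrow> bool list \<Rightarrow> bool) \<Rightarrow> bool" where
  "functionally_complete ar I \<longleftrightarrow>
     (\<forall>n\<ge>1. \<forall>g :: bool list \<Rightarrow> bool. \<exists>x\<in>sentences ar.
        vars x \<subseteq> {..<n} \<and> (\<forall>\<sigma>. eval I \<sigma> x = g (map \<sigma> [0..<n])))"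

fun rpn :: "'c tree \<Rightarrow> (nat + 'c) list" where
  "rpn (Var v) = [Inl v]"
| "rpn (App c ts) = concat (map rpn ts) @ [Inr c]"

definition bit_size :: "((nat + 'c) list \<Rightarrow> bool list) \<Rightarrow> 'c tree \<Rightarrow> nat" where
  "bit_size code x = length (code (rpn x))"

definition num_vars :: "'c tree \<Rightarrow> nat" where
  "num_vars x = card (vars x)"

(* The binary representation of reverse Polish words is arbitrary up to these requirements. *)
definition binary_coding :: "('c \<Rightarrow> nat) \<Rightarrow> ((nat + 'c) list \<Rightarrow> bool list) \<Rightarrow> bool" where
  "binary_coding ar code \<longleftrightarrow>
     inj_on (\<lambda>x. code (rpn x)) (sentences ar) \<and>
     (\<forall>x\<in>sentences ar. 1 \<le> bit_size code x \<and> num_vars x \<le> bit_size code x)"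

definition level :: "'a set \<Rightarrow> ('a \<Rightarrow> nat) \<Rightarrow> nat \<Rightarrow> 'a set" where
  "level X \<alpha> n = {x \<in> X. \<alpha> x = n}"

(* The first entry of a binary sequence is the most significant bit; horner_sum reads the least
   significant one first. *)
definition binary_number :: "bool list \<Rightarrow> nat" where
  "binary_number bs = horner_sum of_bool 2 (rev bs)"

(* The i-th entry of bs is the value of the i-th variable of x in the enumeration order;
   the default False for variables not occurring in x is irrelevant. *)
definition assignment :: "'c tree \<Rightarrow> bool list \<Rightarrow> nat \<Rightarrow> bool" where
  "assignment x bs v =
     (case map_of (zip (sorted_list_of_set (vars x)) bs) v of Some b \<Rightarrow> b | None \<Rightarrow> False)"

definition model :: "('c \<Rightarrow> bool list \<Rightarrow> bool) \<Rightarrow> 'c tree \<Rightarrow> nat set" where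
  "model I x = {binary_number bs | bs. length bs = num_vars x \<and> eval I (assignment x bs) x}"

definition Th :: "('c \<Rightarrow> nat) \<Rightarrow> ('c \<Rightarrow> bool list \<Rightarrow> bool) \<Rightarrow> nat set \<Rightarrow> 'c tree set" where
  "Th ar I K = {x \<in> sentences ar. model I x = K}"

definition min_assignment :: "nat \<Rightarrow> nat set \<Rightarrow> nat" where
  "min_assignment n K = (if K = {} then 2 ^ n else (LEAST k. k \<in> K))"

definition run_time ::
    "('c \<Rightarrow> bool list \<Rightarrow> bool) \<Rightarrow> ((nat + 'c) list \<Rightarrow> bool list) \<Rightarrow> 'c tree \<Rightarrow> nat" where
  "run_time I code x = bit_size code x * (min_assignment (num_vars x) (model I x) + 1)"

definition probability_on :: "'a set \<Rightarrow> ('a \<Rightarrow> real) \<Rightarrow> bool" where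
  "probability_on X \<mu> \<longleftrightarrow> (\<forall>x\<in>X. 0 \<le> \<mu> x \<and> \<mu> x \<le> 1) \<and> (\<mu> has_sum 1) X"

(* Membership of the average time in O(F). Summability is demanded explicitly because infsum is 0
   for a divergent real family. *)
definition avg_in_O ::
    "'a set \<Rightarrow> ('a \<Rightarrow> nat) \<Rightarrow> ('a \<Rightarrow> nat) \<Rightarrow> ('a \<Rightarrow> real) \<Rightarrow> ('a \<Rightarrow> nat) \<Rightarrow> (nat \<Rightarrow> real) \<Rightarrow> bool" where
  "avg_in_O X f \<alpha> \<mu> T F \<longleftrightarrow>
     (\<forall>x\<in>X. 0 < F (f x)) \<and>
     (\<forall>n. infsum \<mu> (level X \<alpha> n) \<noteq> 0 \<longrightarrow>
        (\<lambda>x. real (T x) / F (f x) * \<mu> x) summable_on level X \<alpha> n \<and>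
        (\<Sum>\<^sub>\<infinity>x\<in>level X \<alpha> n. real (T x) / F (f x) * \<mu> x) \<le> infsum \<mu> (level X \<alpha> n))"

end

theory Submission imports Defs begin

text \<open>On the class of sentences with $n$ variables the normalized running time is
  $(\min_n(\mathcal{K}(x)) + 1)/2$, and by hypothesis all $2^N$ possible models, where $N = 2^n$,
  carry the same mass. So it suffices to sum $\min_n(\mathcal{K}) + 1$ over all $\mathcal{K}$.
  This value counts the $j \le N$ with $\mathcal{K} \cap [0,j) = \emptyset$, and for each $j$ there
  are $2^{N-j}$ such $\mathcal{K}$; the total is $2^{N+1} - 1 \le 2 \cdot 2^N$.\<close>

lemma binary_number_less: "binary_number bs < 2 ^ length bs"
  unfolding binary_number_def by (induction bs rule: rev_induct) auto

text \<open>Confines the models of sentences with $n$ variables to finitely many sets, so that a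
  level splits into finitely many classes.\<close>

lemma model_subset: "model I x \<subseteq> {..<2 ^ num_vars x}"
  unfolding model_def by clarsimp (metis binary_number_less)

text \<open>The admissible $j$ form the initial segment ending at \<open>min_assignment n K\<close>.
  Admitting $j = 2^n$ matches the default value $2^n$ for the empty model; a nonempty
  \<open>K\<close> never reaches it.\<close>

lemma Suc_min_assignment_eq_card:
  assumes "K \<subseteq> {..<2 ^ n}"
  shows "Suc (min_assignment n K) = card {j \<in> {..2 ^ n}. K \<inter> {..<j} = {}}"
proof (cases "K = {}")
  case True
  then show ?thesis by (simp add: min_assignment_def)
next
  case False
  define m where "m = (LEAST k. k \<in> K)"
  have m: "m \<in> K" "\<And>k. k \<in> K \<Longrightarrow> m \<le> k"
    using False by (auto simp: m_def intro: LeastI Least_le)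
  have "{j \<in> {..2 ^ n}. K \<inter> {..<j} = {}} = {..m}"
  proof (intro equalityI subsetI)
    fix j assume "j \<in> {j \<in> {..2 ^ n}. K \<inter> {..<j} = {}}"
    then have "m \<notin> {..<j}" using m(1) by blast
    then show "j \<in> {..m}" by simp
  next
    fix j assume "j \<in> {..m}"
    moreover have "m < 2 ^ n" using m(1) assms by auto
    ultimately show "j \<in> {j \<in> {..2 ^ n}. K \<inter> {..<j} = {}}"
      using m(2) by fastforce
  qed
  then show ?thesis using False by (simp add: min_assignment_def m_def)
qed

lemma sum_Suc_min_assignment_le:
  "(\<Sum>K\<in>Pow {..<2 ^ n}. Suc (min_assignment n K)) \<le> 2 * 2 ^ 2 ^ n"
proof -
  define N :: nat where "N = 2 ^ n"
  have "(\<Sum>K\<in>Pow {..<N}. Suc (min_assignment n K))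
      = (\<Sum>K\<in>Pow {..<N}. card {j \<in> {..N}. K \<inter> {..<j} = {}})"
    unfolding N_def by (intro sum.cong refl Suc_min_assignment_eq_card) auto
  also have "\<dots> = (\<Sum>j\<le>N. card {K \<in> Pow {..<N}. K \<inter> {..<j} = {}})"
    \<comment> \<open>Double counting of the pairs $(K, j)$ with $K$ disjoint from $[0,j)$.\<close>
    by (rule sum_multicount_gen) auto
  also have "\<dots> = (\<Sum>j\<le>N. 2 ^ (N - j))"
  proof (rule sum.cong)
    fix j
    have "{K \<in> Pow {..<N}. K \<inter> {..<j} = {}} = Pow {j..<N}"
      by (fastforce simp: not_less[symmetric])
    then show "card {K \<in> Pow {..<N}. K \<inter> {..<j} = {}} = 2 ^ (N - j)"
      by (simp add: card_Pow)
  qed simp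
  also have "\<dots> = (\<Sum>j\<le>N. 2 ^ j)"
    using sum.nat_diff_reindex[of "\<lambda>j. (2::nat) ^ j" "Suc N"] by (simp add: lessThan_Suc_atMost)
  also have "\<dots> \<le> 2 * 2 ^ N"
    by (induction N) auto
  finally show ?thesis unfolding N_def .
qed

theorem mainTheorem1:
  fixes ar :: "'c \<Rightarrow> nat"
    and I :: "'c \<Rightarrow> bool list \<Rightarrow> bool"
    and code :: "(nat + 'c) list \<Rightarrow> bool list"
    and \<mu> :: "'c tree \<Rightarrow> real"
  assumes "functionally_complete ar I"
    and "binary_coding ar code"
    and "probability_on (sentences ar) \<mu>"
    and "\<And>n K L. K \<subseteq> {0..2 ^ n - 1} \<Longrightarrow> L \<subseteq> {0..2 ^ n - 1} \<Longrightarrow>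
           infsum \<mu> (level (sentences ar) num_vars n \<inter> Th ar I K) =
           infsum \<mu> (level (sentences ar) num_vars n \<inter> Th ar I L)"
  shows "avg_in_O (sentences ar) (bit_size code) num_vars \<mu> (run_time I code) (\<lambda>k. 2 * real k)"
proof -
  define X where "X = sentences ar"
  define T where "T x = real (run_time I code x) / (2 * real (bit_size code x)) * \<mu> x" for x
  have size: "bit_size code x \<noteq> 0" if "x \<in> X" for x
    using assms(2) that unfolding binary_coding_def X_def by force
  have nonneg: "\<mu> x \<ge> 0" if "x \<in> X" for x
    using assms(3) that by (simp add: probability_on_def X_def)
  have summable: "\<mu> summable_on X"
    using assms(3) by (auto simp: probability_on_def X_def summable_on_def)
  have average: "T summable_on level X num_vars n \<and>
      infsum T (level X num_vars n) \<le> infsum \<mu> (level X num_vars n)" for n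
  proof -
    define P where "P = Pow {..<(2::nat) ^ n}"
    define A where "A K = level X num_vars n \<inter> Th ar I K" for K
    \<comment> \<open>The common mass of all classes; the empty model serves as representative
      because it is available for every \<open>n\<close>.\<close>
    define m where "m = infsum \<mu> (A {})"
    define c where "c K = real (Suc (min_assignment n K)) / 2" for K
    have fin: "finite P" by (simp add: P_def)
    have "{..<(2::nat) ^ n} = {0..2 ^ n - 1}"
      using lessThan_Suc_atMost[of "2 ^ n - 1"] by (simp add: atLeast0AtMost)
    then have Pow_eq: "P = Pow {0..2 ^ n - 1}"
      by (simp only: P_def)
    \<comment> \<open>Grouping by model partitions the level into finitely many classes, so sums
      over the level add up class by class.\<close>
    have level_eq: "level X num_vars n = (\<Union>K\<in>P. A K)"
      using model_subset[of I] by (auto simp: A_def P_def level_def Th_def X_def)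
    have disj: "A K \<inter> A L = {}" if "K \<noteq> L" for K L
      using that by (auto simp: A_def Th_def)
    have mass: "(\<mu> has_sum m) (A K)" if "K \<in> P" for K
    proof -
      have "infsum \<mu> (A K) = m"
        using assms(4)[of K n "{}"] that by (simp add: Pow_eq A_def m_def X_def)
      \<comment> \<open>Equality of \<open>infsum\<close> alone would not exclude its default value
        0 for a divergent family.\<close>
      moreover have "\<mu> summable_on A K"
        by (rule summable_on_subset[OF summable]) (auto simp: A_def level_def)
      ultimately show ?thesis by (simp add: has_sum_iff)
    qed
    \<comment> \<open>The positive size cancels, and the minimum depends only on \<open>K\<close>;
      hence \<open>T\<close> is a constant multiple of \<open>\<mu>\<close> on each class.\<close>
    have T_on_A: "(T has_sum c K * m) (A K)" if "K \<in> P" for K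
    proof -
      have "T x = c K * \<mu> x" if "x \<in> A K" for x
        using that size[of x]
        by (simp add: T_def c_def A_def Th_def level_def run_time_def field_simps)
      then show ?thesis
        using has_sum_cmult_right[OF mass[OF that], of "c K"] by (simp cong: has_sum_cong)
    qed
    have "(\<mu> has_sum (\<Sum>K\<in>P. m)) (level X num_vars n)"
      unfolding level_eq by (rule sum_has_sum[OF fin mass disj])
    then have level_mass: "infsum \<mu> (level X num_vars n) = 2 ^ 2 ^ n * m"
      by (simp add: infsumI P_def card_Pow)
    have level_T: "(T has_sum (\<Sum>K\<in>P. c K * m)) (level X num_vars n)"
      unfolding level_eq by (rule sum_has_sum[OF fin T_on_A disj])
    have "m \<ge> 0"
      unfolding m_def by (rule infsum_nonneg) (auto simp: A_def level_def nonneg)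
    \<comment> \<open>The 2 in the denominator of \<open>c\<close>, coming from the bound $2k$,
      absorbs the factor 2 of the counting lemma: the average of \<open>c\<close> over all models is
      at most 1.\<close>
    moreover have "(\<Sum>K\<in>P. c K) \<le> 2 ^ 2 ^ n"
    proof -
      have "real (\<Sum>K\<in>P. Suc (min_assignment n K)) \<le> real (2 * 2 ^ 2 ^ n)"
        unfolding P_def of_nat_le_iff by (rule sum_Suc_min_assignment_le)
      then show ?thesis
        unfolding c_def sum_divide_distrib[symmetric] of_nat_sum[symmetric] by simp
    qed
    ultimately have "(\<Sum>K\<in>P. c K * m) \<le> 2 ^ 2 ^ n * m"
      unfolding sum_distrib_right[symmetric] by (rule mult_right_mono[rotated])
    then show ?thesis
      using level_T level_mass by (simp add: has_sum_iff)
  qed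
  show ?thesis
    using average size unfolding avg_in_O_def T_def X_def by simp
qed

end
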